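(* Let $n,N\in\mathbb N$, $p\in[1,2]$, and let $\mathbb P_{\rm true}$ be a probability distribution on $\mathcal S^n$ with finite $p$-th moment for which there exists $c>0$ such that $$W_p(\mathbb P,\mathbb P_{\rm true})\le\sqrt{2c\,D(\mathbb P\,\|\,\mathbb P_{\rm true})}\quad\text{for all probability distributions }\mathbb P\text{ on }\mathcal S^n\text{ with finite }p\text{-th moment}.$$ For $0<\beta<1$ put $\theta_{c,N}(\beta)=\sqrt{\frac{2c\log(1/\beta)}N}$. Then for any $\mathbf y\in\mathbb S^{n-1}$, $$\mathbb P_{\rm true}^N\Big[\mathbf y^\top\big(\mathbb E_{\widehat{\mathbb P}_N}[\widetilde{\mathsf Q}]-\mathbb E_{\mathbb P_{\rm true}}[\widetilde{\mathsf Q}]\big)\mathbf y\le\theta_{c,N}(\beta)\Big]\ge1-\beta.$$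
   Context: $\mathcal S^n$ is the space of real symmetric $n\times n$ matrices with the Frobenius norm $\|\cdot\|_F$, identified isometrically with $\mathbb R^m$, $m=\frac{n(n+1)}2$, with the Euclidean norm. $W_p(\mathbb P,\mathbb P')=\big(\inf_\pi\int\|\mathsf Q-\mathsf Q'\|_F^p\,\mathrm d\pi\big)^{1/p}$ over couplings $\pi$ of $\mathbb P,\mathbb P'$. $D(\mathbb P\|\mathbb P')=\int\log\big(\frac{\mathrm d\mathbb P}{\mathrm d\mathbb P'}\big)\mathrm d\mathbb P$ if $\mathbb P\ll\mathbb P'$ and $=\infty$ otherwise (Kullback–Leibler divergence). $\mathbb S^{n-1}$ is the Euclidean unit sphere in $\mathbb R^n$. $\widehat{\mathsf Q}_1,\dots,\widehat{\mathsf Q}_N$ are i.i.d. from $\mathbb P_{\rm true}$ with joint law $\mathbb P_{\rm true}^N$, and $\mathbb E_{\widehat{\mathbb P}_N}[\widetilde{\mathsf Q}]=\frac1N\sum_{i=1}^N\widehat{\mathsf Q}_i$. *)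

theory Defs
  imports "HOL-Probability.Probability"
begin

text \<open>
  The library norm on \<^typ>\<open>real^'n^'n\<close> is the Frobenius norm (see \<open>norm_eq_frobenius\<close> below), and
  \<open>sym_mats\<close> carries the norm and the Borel sets that it inherits as a subspace.
\<close>

definition sym_mats :: "(real^'n^'n) set" where
  "sym_mats = {A. transpose A = A}"

lemma norm_eq_frobenius:
  fixes A :: "real^'n^'n"
  shows "norm A = sqrt (\<Sum>i\<in>UNIV. \<Sum>j\<in>UNIV. (A $ i $ j)\<^sup>2)"
  by (simp add: norm_vec_def L2_set_def real_sqrt_pow2 sum_nonneg)

definition sym_distribution :: "(real^'n^'n) measure \<Rightarrow> bool" where
  "sym_distribution P \<longleftrightarrow> prob_space P \<and> sets P = sets (restrict_space borel sym_mats)"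

definition finite_moment :: "real \<Rightarrow> 'a::real_normed_vector measure \<Rightarrow> bool" where
  "finite_moment p P \<longleftrightarrow> (\<integral>\<^sup>+ Q. ennreal (norm Q powr p) \<partial>P) < \<infinity>"

text \<open>Real powers on \<open>[0, \<infinity>]\<close>, intended for positive exponents.\<close>

definition ennreal_powr :: "ennreal \<Rightarrow> real \<Rightarrow> ennreal" where
  "ennreal_powr x a = (if x = \<infinity> then \<infinity> else ennreal (enn2real x powr a))"

definition couplings :: "'a measure \<Rightarrow> 'b measure \<Rightarrow> ('a \<times> 'b) measure set" where
  "couplings P P' = {\<pi>. sets \<pi> = sets (P \<Otimes>\<^sub>M P') \<and> distr \<pi> P fst = P \<and> distr \<pi> P' snd = P'}"

definition wasserstein ::
    "real \<Rightarrow> 'a::real_normed_vector measure \<Rightarrow> 'a measure \<Rightarrow> ennreal" where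
  "wasserstein p P P' =
     ennreal_powr (INF \<pi>\<in>couplings P P'. \<integral>\<^sup>+ (Q, Q'). ennreal (norm (Q - Q') powr p) \<partial>\<pi>) (1 / p)"

text \<open>
  The library's \<^term>\<open>KL_divergence b M N\<close> is the Bochner integral of \<open>log b (dN/dM)\<close> with
  respect to \<open>N\<close>, so the arguments appear in the opposite order, and its value is \<open>0\<close> when that
  function is not integrable. For probability measures \<open>P \<lless> P'\<close> the negative part of \<open>ln (dP/dP')\<close>
  always has finite integral with respect to \<open>P\<close>. Hence failure of integrability means that the
  divergence is \<open>\<infinity>\<close>; otherwise it is a nonnegative real (\<open>KL_divergence_nonneg\<close>), which
  \<^term>\<open>ennreal\<close> leaves unchanged.
\<close>

definition rel_entropy :: "'a measure \<Rightarrow> 'a measure \<Rightarrow> ennreal" where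
  "rel_entropy P P' =
     (if absolutely_continuous P' P \<and> integrable P (entropy_density (exp 1) P' P)
      then ennreal (KL_divergence (exp 1) P' P) else \<infinity>)"

lemma KL_divergence_nonneg:
  assumes "prob_space P" "prob_space P'" "sets P = sets P'" "absolutely_continuous P' P"
    and "integrable P (entropy_density (exp 1) P' P)"
  shows "0 \<le> KL_divergence (exp 1) P' P"
proof -
  interpret P: prob_space P by fact
  interpret P': prob_space P' by fact
  interpret I: information_space P' "exp 1" by unfold_locales simp
  have "finite_measure P" by unfold_locales
  from P'.real_RN_deriv[OF this assms(4,3)] obtain D :: "'a \<Rightarrow> real" where
    D: "D \<in> borel_measurable P'" "AE x in P'. RN_deriv P' P x = ennreal (D x)" "\<And>x. 0 \<le> D x"
    by blast
  have "P = density P' (RN_deriv P' P)"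
    using assms(3,4) by (simp add: P'.density_RN_deriv)
  also have "\<dots> = density P' D"
    using D by (auto intro!: density_cong)
  finally have P: "P = density P' D" .
  have "AE x in P. RN_deriv P' P x = ennreal (D x)"
    using absolutely_continuous_AE[OF assms(3,4) D(2)] .
  then have "AE x in P. log (exp 1) (D x) = entropy_density (exp 1) P' P x"
    by eventually_elim (simp add: entropy_density_def D(3))
  moreover have "D \<in> borel_measurable P"
    using D(1) assms(3) by (simp cong: measurable_cong_sets)
  moreover have "entropy_density (exp 1) P' P \<in> borel_measurable P"
    using assms(5) by (rule borel_measurable_integrable)
  ultimately have "integrable P (\<lambda>x. log (exp 1) (D x))"
    using assms(5) by (subst integrable_cong_AE) auto
  then have "integrable P' (\<lambda>x. D x * log (exp 1) (D x))"
    using D(1,3) by (subst (asm) P, subst (asm) integrable_real_density) auto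
  moreover have "prob_space (density P' D)"
    using assms(1) P by simp
  ultimately have "0 \<le> KL_divergence (exp 1) P' (density P' D)"
    using D by (intro I.KL_nonneg) auto
  then show ?thesis
    by (simp flip: P)
qed

end

theory Submission
  imports Defs
begin

text \<open>
  For a unit vector \<open>y\<close> the map \<open>g A = y \<bullet> (A *v y)\<close> is linear and 1-Lipschitz for the Frobenius
  norm, so the claim is a Gaussian upper tail bound for the empirical mean of a Lipschitz function.
  Such a bound follows from the transport-entropy inequality by the argument of Bobkov and Goetze.

  Write \<open>M\<close> for the true distribution and let \<open>s \<ge> 0\<close>. Tilting \<open>M\<close> by the density \<open>exp (s * g) / Z\<close>,
  where \<open>Z = \<integral>exp (s * g) dM\<close>, gives a distribution \<open>P\<close> that attains equality in the Gibbs
  variational principle: \<open>ln Z = s * \<integral>g dP - D\<close> with \<open>D\<close> the relative entropy of \<open>P\<close> to \<open>M\<close>.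
  Since \<open>g\<close> is 1-Lipschitz, \<open>\<integral>g dP - \<integral>g dM\<close> is at most the Wasserstein distance of \<open>P\<close> and \<open>M\<close>
  (\<open>mean_difference_le_wasserstein\<close>), which is at most \<open>r = sqrt (2 * c * D)\<close> by assumption. As
  \<open>D = r\<^sup>2 / (2 * c)\<close>, this yields \<open>ln Z - s * \<integral>g dM \<le> s * r - r\<^sup>2 / (2 * c) \<le> c * s\<^sup>2 / 2\<close>, that is,
  \<open>g\<close> is sub-Gaussian with variance proxy \<open>c\<close>. For unbounded \<open>g\<close> it is not known beforehand that
  \<open>Z\<close> is finite or that \<open>P\<close> has a finite moment; the argument is therefore run on the functions
  \<open>min g k\<close>, which are still 1-Lipschitz (\<open>exp_moment_le_of_bounded_above\<close>), and monotone
  convergence removes the truncation (\<open>exp_moment_le_of_lipschitz\<close>).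

  Exponential moments of independent summands multiply, and Chernoff's method then bounds the
  probability that the empirical mean exceeds its expectation by at least \<open>t\<close> by
  \<open>exp (- N * t\<^sup>2 / (2 * c))\<close> (\<open>sample_mean_deviation\<close>). The radius in the theorem is the \<open>t\<close> for
  which this equals \<open>\<beta>\<close>.
\<close>

section \<open>Moments and Lipschitz functions\<close>

text \<open>
  Jensen's inequality for \<open>t \<mapsto> t powr p\<close> on the closed half-line. It is obtained by integrating
  Young's inequality \<open>a powr (1/p) \<le> a / p + (1 - 1/p)\<close> at \<open>a = u powr p / E[u powr p]\<close>; when
  the denominator is zero, \<open>u\<close> vanishes almost surely.
\<close>

lemma (in prob_space) expectation_le_powr_expectation:
  fixes u :: "'a \<Rightarrow> real"
  assumes "p \<ge> 1" "integrable M u" "\<And>x. 0 \<le> u x" "integrable M (\<lambda>x. u x powr p)"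
  shows "expectation u \<le> expectation (\<lambda>x. u x powr p) powr (1 / p)"
proof (cases "expectation (\<lambda>x. u x powr p) = 0")
  case True
  then have "AE x in M. u x powr p = 0"
    using assms by (subst (asm) integral_nonneg_eq_0_iff_AE) auto
  then have "AE x in M. u x = 0"
    by eventually_elim simp
  then have "expectation u = 0"
    using integral_eq_zero_AE by blast
  then show ?thesis
    using True by simp
next
  case False
  define K where "K = expectation (\<lambda>x. u x powr p)"
  have "0 \<le> K"
    unfolding K_def by (intro integral_nonneg_AE) auto
  with False have K: "K > 0"
    unfolding K_def by linarith
  have young: "u x / K powr (1 / p) \<le> (1 / p) * (u x powr p / K) + (1 - 1 / p)" for x
  proof (cases "u x = 0")
    case True
    then show ?thesis using assms(1) by simp
  next
    case False
    then have "u x > 0" using assms(3)[of x] by simp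
    moreover have "(u x powr p / K) powr (1 / p) = u x / K powr (1 / p)"
      using \<open>u x > 0\<close> K assms(1) by (simp add: powr_divide powr_powr)
    ultimately show ?thesis
      using Youngs_inequality_0[of "1 / p" "1 - 1 / p" "u x powr p / K" 1] K assms(1)
      by simp
  qed
  have "expectation (\<lambda>x. u x / K powr (1 / p))
      \<le> expectation (\<lambda>x. (1 / p) * (u x powr p / K) + (1 - 1 / p))"
    using assms by (intro integral_mono young) auto
  also have "\<dots> = (1 / p) * (K / K) + (1 - 1 / p)"
    using assms unfolding K_def by (subst Bochner_Integration.integral_add) (auto simp: prob_space)
  also have "\<dots> = 1"
    using K by simp
  finally show ?thesis
    using K by (simp add: K_def divide_le_eq)
qed

lemma le_one_plus_powr:
  fixes t :: real
  assumes "p \<ge> 1"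
  shows "t \<le> 1 + t powr p"
  using powr_mono[OF assms, of t] by (cases "t \<ge> 1") (auto simp: add_increasing2)

lemma integrable_norm_of_finite_moment:
  fixes M :: "'a::{real_normed_vector, second_countable_topology} measure"
  assumes "prob_space M" "(\<lambda>x. x) \<in> borel_measurable M" "p \<ge> 1" "finite_moment p M"
  shows "integrable M norm"
proof -
  interpret prob_space M by fact
  note [measurable] = assms(2)
  have "integrable M (\<lambda>x. norm x powr p)"
    using assms(4) by (intro integrableI_bounded) (auto simp: finite_moment_def)
  then have "integrable M (\<lambda>x. 1 + norm x powr p)"
    by simp
  then show ?thesis
  proof (rule Bochner_Integration.integrable_bound)
    show "AE x in M. norm (norm x) \<le> norm (1 + norm x powr p)"
      using le_one_plus_powr[OF assms(3)] by (intro AE_I2) simp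
  qed measurable
qed

lemma lipschitz_integrable:
  fixes M :: "'a::{real_normed_vector, second_countable_topology} measure" and g :: "'a \<Rightarrow> real"
  assumes "prob_space M" "integrable M norm" "g \<in> borel_measurable M"
    and "\<And>x y. \<bar>g x - g y\<bar> \<le> norm (x - y)"
  shows "integrable M g"
proof -
  interpret prob_space M by fact
  have "integrable M (\<lambda>x. \<bar>g 0\<bar> + norm x)"
    using assms(2) by simp
  then show ?thesis
  proof (rule Bochner_Integration.integrable_bound)
    show "AE x in M. norm (g x) \<le> norm (\<bar>g 0\<bar> + norm x)"
      using assms(4)[of _ 0] by (intro AE_I2) (smt (verit) diff_zero real_norm_def norm_ge_zero)
  qed fact
qed

section \<open>Wasserstein distance and Lipschitz functions\<close>

text \<open>
  The easy half of Kantorovich duality: under any coupling the difference of the means is the mean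
  of \<open>g Q - g Q'\<close>, hence at most the mean of \<open>norm (Q - Q')\<close>, and Jensen's inequality passes from
  this first-order cost to the one of order \<open>p\<close>.
\<close>

lemma mean_difference_le_wasserstein:
  fixes P M :: "'a::{real_normed_vector, second_countable_topology} measure" and g :: "'a \<Rightarrow> real"
  assumes "prob_space P" "p \<ge> 1"
    and id: "(\<lambda>x. x) \<in> borel_measurable P" "(\<lambda>x. x) \<in> borel_measurable M"
    and g: "integrable P g" "integrable M g"
    and lip: "\<And>x y. \<bar>g x - g y\<bar> \<le> norm (x - y)"
  shows "ennreal ((\<integral>x. g x \<partial>P) - (\<integral>x. g x \<partial>M)) \<le> wasserstein p P M"
proof -
  define d where "d = (\<integral>x. g x \<partial>P) - (\<integral>x. g x \<partial>M)"
  define I where "I = (INF \<pi>\<in>couplings P M. \<integral>\<^sup>+ (Q, Q'). ennreal (norm (Q - Q') powr p) \<partial>\<pi>)"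
  \<comment> \<open>The positive part makes the power meaningful when the difference of means is negative.\<close>
  have cost: "ennreal (max d 0 powr p) \<le> (\<integral>\<^sup>+ (Q, Q'). ennreal (norm (Q - Q') powr p) \<partial>\<pi>)"
    if \<pi>: "\<pi> \<in> couplings P M" for \<pi>
  proof (cases "(\<integral>\<^sup>+ (Q, Q'). ennreal (norm (Q - Q') powr p) \<partial>\<pi>) = \<infinity>")
    case True
    then show ?thesis by simp
  next
    case False
    have sets[measurable_cong]: "sets \<pi> = sets (P \<Otimes>\<^sub>M M)"
      and fst: "distr \<pi> P fst = P" and snd: "distr \<pi> M snd = M"
      using \<pi> by (auto simp: couplings_def)
    note [measurable] = id borel_measurable_integrable[OF g(1)] borel_measurable_integrable[OF g(2)]
    have [measurable]: "(\<lambda>z. fst z) \<in> borel_measurable \<pi>" "(\<lambda>z. snd z) \<in> borel_measurable \<pi>"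
      using measurable_compose[OF measurable_fst id(1), of M]
        measurable_compose[OF measurable_snd id(2), of P]
      by (simp_all cong: measurable_cong_sets add: sets)
    have mf: "fst \<in> \<pi> \<rightarrow>\<^sub>M P" and ms: "snd \<in> \<pi> \<rightarrow>\<^sub>M M"
      by measurable
    interpret prob_space \<pi>
      using mf by (rule prob_space_distrD) (simp add: fst assms(1))
    have intp: "integrable \<pi> (\<lambda>z. norm (fst z - snd z) powr p)"
      using False by (intro integrableI_bounded) (auto simp: case_prod_unfold top.not_eq_extremum)
    have int: "integrable \<pi> (\<lambda>z. norm (fst z - snd z))"
    proof (rule Bochner_Integration.integrable_bound)
      show "integrable \<pi> (\<lambda>z. 1 + norm (fst z - snd z) powr p)"
        using intp by simp
      show "AE z in \<pi>. norm (norm (fst z - snd z)) \<le> norm (1 + norm (fst z - snd z) powr p)"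
        using le_one_plus_powr[OF assms(2)] by (intro AE_I2) simp
    qed measurable
    have gi: "integrable \<pi> (\<lambda>z. g (fst z))" "integrable \<pi> (\<lambda>z. g (snd z))"
      using integrable_distr[OF mf, of g] integrable_distr[OF ms, of g] g by (simp_all add: fst snd)
    have "(\<integral>x. g x \<partial>P) = (\<integral>z. g (fst z) \<partial>\<pi>)" "(\<integral>x. g x \<partial>M) = (\<integral>z. g (snd z) \<partial>\<pi>)"
      using integral_distr[OF mf, of g] integral_distr[OF ms, of g] g by (simp_all add: fst snd)
    then have "d = (\<integral>z. g (fst z) - g (snd z) \<partial>\<pi>)"
      using gi by (simp add: d_def)
    also have "\<dots> \<le> (\<integral>z. norm (fst z - snd z) \<partial>\<pi>)"
      using lip abs_le_D1 by (intro integral_mono int Bochner_Integration.integrable_diff gi) blast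
    also have "\<dots> \<le> (\<integral>z. norm (fst z - snd z) powr p \<partial>\<pi>) powr (1 / p)"
      using assms(2) int intp by (intro expectation_le_powr_expectation) auto
    finally have "max d 0 powr p \<le> ((\<integral>z. norm (fst z - snd z) powr p \<partial>\<pi>) powr (1 / p)) powr p"
      using assms(2) by (intro powr_mono2) auto
    also have "\<dots> = (\<integral>z. norm (fst z - snd z) powr p \<partial>\<pi>)"
      using assms(2) by (simp add: powr_powr)
    finally show ?thesis
      using intp by (simp add: case_prod_unfold nn_integral_eq_integral)
  qed
  then have le: "ennreal (max d 0 powr p) \<le> I"
    unfolding I_def by (intro INF_greatest)
  have "ennreal d \<le> ennreal_powr I (1 / p)"
  proof (cases "I = \<infinity>")
    case True
    then show ?thesis by (simp add: ennreal_powr_def)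
  next
    case False
    then have "max d 0 powr p \<le> enn2real I"
      using enn2real_mono[OF le] by (simp add: top.not_eq_extremum)
    then have "(max d 0 powr p) powr (1 / p) \<le> enn2real I powr (1 / p)"
      using assms(2) by (intro powr_mono2) auto
    then have "d \<le> enn2real I powr (1 / p)"
      using assms(2) by (simp add: powr_powr)
    then show ?thesis
      using False by (simp add: ennreal_powr_def ennreal_leI)
  qed
  then show ?thesis
    by (simp add: d_def I_def wasserstein_def)
qed

section \<open>Sub-Gaussian exponential moments\<close>

text \<open>
  This is Talagrand's inequality \<open>T\<^sub>p\<close> with constant \<open>c\<close>. The competitors \<open>P\<close> live on the
  \<open>\<sigma>\<close>-algebra of \<open>M\<close>, so that distributions concentrated on a subspace are covered as well.
\<close>

definition transport_entropy :: "real \<Rightarrow> real \<Rightarrow> 'a::real_normed_vector measure \<Rightarrow> bool" where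
  "transport_entropy p c M \<longleftrightarrow>
     (\<forall>P. prob_space P \<and> sets P = sets M \<and> finite_moment p P \<longrightarrow>
        wasserstein p P M \<le> ennreal_powr (ennreal (2 * c) * rel_entropy P M) (1 / 2))"

text \<open>
  The upper bound on \<open>g\<close> makes the density of the tilted measure bounded. Hence the tilted measure
  inherits the finite moment of \<open>M\<close> and may be inserted into the transport-entropy inequality.
\<close>

lemma exp_moment_le_of_bounded_above:
  fixes M :: "'a::{real_normed_vector, second_countable_topology} measure" and g :: "'a \<Rightarrow> real"
  assumes "prob_space M" "p \<ge> 1" and id: "(\<lambda>x. x) \<in> borel_measurable M"
    and "finite_moment p M" "transport_entropy p c M" "c > 0"
    and g: "g \<in> borel_measurable M" "\<And>x. g x \<le> K"
    and lip: "\<And>x y. \<bar>g x - g y\<bar> \<le> norm (x - y)" and "0 \<le> s"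
  shows "(\<integral>\<^sup>+x. ennreal (exp (s * g x)) \<partial>M) \<le> ennreal (exp (s * (\<integral>x. g x \<partial>M) + c * s\<^sup>2 / 2))"
proof -
  interpret M: prob_space M by fact
  note [measurable] = id g(1)
  have gM: "integrable M g"
    using assms(1) integrable_norm_of_finite_moment[OF assms(1) id assms(2,4)] g(1) lip
    by (rule lipschitz_integrable)
  have exp_le: "exp (s * g x) \<le> exp (s * K)" for x
    using g(2)[of x] \<open>0 \<le> s\<close> by (simp add: mult_left_mono)
  have exp_int: "integrable M (\<lambda>x. exp (s * g x))"
    using exp_le by (intro M.integrable_const_bound[of _ "exp (s * K)"]) auto
  define Z where "Z = (\<integral>x. exp (s * g x) \<partial>M)"
  have "Z \<ge> 0"
    unfolding Z_def by (intro integral_nonneg_AE) auto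
  moreover have "Z \<noteq> 0"
    unfolding Z_def using exp_int
    by (subst integral_nonneg_eq_0_iff_AE) auto
  ultimately have Z: "Z > 0" by simp
  define h where "h = (\<lambda>x. exp (s * g x) / Z)"
  have h[measurable]: "h \<in> borel_measurable M"
    by (simp add: h_def)
  have h0: "0 < h x" for x
    using Z by (simp add: h_def)
  have h_le: "h x \<le> exp (s * K) / Z" for x
    using exp_le[of x] Z by (simp add: h_def divide_right_mono)
  define P where "P = density M (\<lambda>x. ennreal (h x))"
  have sets_P[measurable_cong]: "sets P = sets M"
    by (simp add: P_def)
  have "(\<integral>\<^sup>+x. ennreal (h x) \<partial>M) = ennreal (\<integral>x. h x \<partial>M)"
    using exp_int h0 by (intro nn_integral_eq_integral) (auto simp: h_def less_imp_le)
  also have "(\<integral>x. h x \<partial>M) = 1"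
    using Z by (simp add: h_def Z_def)
  finally have P: "prob_space P"
    unfolding P_def by (intro prob_spaceI) (simp add: emeasure_density cong: nn_integral_cong)
  interpret P: prob_space P by fact
  have "(\<integral>\<^sup>+x. ennreal (norm x powr p) \<partial>P) = (\<integral>\<^sup>+x. ennreal (h x) * ennreal (norm x powr p) \<partial>M)"
    unfolding P_def by (intro nn_integral_density) measurable
  also have "\<dots> \<le> (\<integral>\<^sup>+x. ennreal (exp (s * K) / Z) * ennreal (norm x powr p) \<partial>M)"
    by (intro nn_integral_mono mult_right_mono ennreal_leI h_le) simp
  also have "\<dots> = ennreal (exp (s * K) / Z) * (\<integral>\<^sup>+x. ennreal (norm x powr p) \<partial>M)"
    by (intro nn_integral_cmult) measurable
  also have "\<dots> < \<infinity>"
    using assms(4) by (simp add: finite_moment_def ennreal_mult_less_top)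
  finally have mom: "finite_moment p P"
    by (simp add: finite_moment_def)
  have idP: "(\<lambda>x. x) \<in> borel_measurable P" and gmP: "g \<in> borel_measurable P"
    by measurable
  have gP: "integrable P g"
    using P integrable_norm_of_finite_moment[OF P idP assms(2) mom] gmP lip
    by (rule lipschitz_integrable)
  have ac: "absolutely_continuous M P"
    unfolding P_def by (intro absolutely_continuousI_density) simp
  \<comment> \<open>The log-density of the tilted measure is affine in \<open>g\<close>: this is the equality case of the
    Gibbs variational principle.\<close>
  have "AE x in M. ennreal (h x) = RN_deriv M P x"
    by (rule M.RN_deriv_unique) (simp_all add: P_def)
  then have "AE x in P. ennreal (h x) = RN_deriv M P x"
    using ac sets_P absolutely_continuous_AE by metis
  then have dens: "AE x in P. entropy_density (exp 1) M P x = s * g x - ln Z"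
  proof eventually_elim
    case (elim x)
    have "entropy_density (exp 1) M P x = ln (h x)"
      by (simp add: entropy_density_def flip: elim) (use h0[of x] in \<open>simp add: log_def\<close>)
    then show ?case
      using Z by (simp add: h_def ln_div)
  qed
  have [measurable]: "entropy_density (exp 1) M P \<in> borel_measurable P"
    using measurable_entropy_density by (simp cong: measurable_cong_sets add: sets_P)
  have int: "integrable P (entropy_density (exp 1) M P)"
    using gP by (subst integrable_cong_AE[OF _ _ dens]) auto
  define D where "D = s * (\<integral>x. g x \<partial>P) - ln Z"
  have D: "KL_divergence (exp 1) M P = D"
    unfolding KL_divergence_def D_def using gP
    by (subst integral_cong_AE[OF _ _ dens]) (auto simp: P.prob_space)
  have "0 \<le> D"
    using KL_divergence_nonneg[OF P M.prob_space_axioms sets_P ac int] by (simp add: D)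
  define d where "d = (\<integral>x. g x \<partial>P) - (\<integral>x. g x \<partial>M)"
  have "ennreal d \<le> wasserstein p P M"
    unfolding d_def using P assms(2) idP id gP gM lip
    by (rule mean_difference_le_wasserstein)
  also have "\<dots> \<le> ennreal_powr (ennreal (2 * c) * rel_entropy P M) (1 / 2)"
    using assms(5) P mom sets_P by (simp add: transport_entropy_def)
  also have "\<dots> = ennreal (sqrt (2 * c * D))"
    using ac int \<open>0 \<le> D\<close> \<open>c > 0\<close>
    by (simp add: rel_entropy_def D ennreal_powr_def powr_half_sqrt ennreal_mult_eq_top_iff flip: ennreal_mult)
  finally have d: "d \<le> sqrt (2 * c * D)"
    using \<open>0 \<le> D\<close> \<open>c > 0\<close> by (subst (asm) ennreal_le_iff) auto
  \<comment> \<open>Completing the square in \<open>r\<close> eliminates the unknown entropy.\<close>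
  define r where "r = sqrt (2 * c * D)"
  have "D = r\<^sup>2 / (2 * c)"
    using \<open>0 \<le> D\<close> \<open>c > 0\<close> by (simp add: r_def)
  then have "ln Z - s * (\<integral>x. g x \<partial>M) = s * d - r\<^sup>2 / (2 * c)"
    by (simp add: D_def d_def algebra_simps)
  also have "\<dots> \<le> s * r - r\<^sup>2 / (2 * c)"
    using d \<open>0 \<le> s\<close> by (simp add: r_def mult_left_mono)
  also have "\<dots> = c * s\<^sup>2 / 2 - (c * s - r)\<^sup>2 / (2 * c)"
    using \<open>c > 0\<close> by (simp add: field_simps power2_eq_square)
  also have "\<dots> \<le> c * s\<^sup>2 / 2"
    using \<open>c > 0\<close> by simp
  finally have "ln Z \<le> s * (\<integral>x. g x \<partial>M) + c * s\<^sup>2 / 2"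
    by simp
  then have "Z \<le> exp (s * (\<integral>x. g x \<partial>M) + c * s\<^sup>2 / 2)"
    using Z by (simp flip: ln_ge_iff ln_le_cancel_iff)
  then show ?thesis
    using exp_int by (simp add: nn_integral_eq_integral Z_def ennreal_leI)
qed

text \<open>
  Truncation from above keeps the Lipschitz constant and can only lower the mean. The right-hand
  side for \<open>g\<close> therefore bounds the exponential moments of all truncations, and their supremum is
  the exponential moment of \<open>g\<close> by monotone convergence.
\<close>

lemma exp_moment_le_of_lipschitz:
  fixes M :: "'a::{real_normed_vector, second_countable_topology} measure" and g :: "'a \<Rightarrow> real"
  assumes "prob_space M" "p \<ge> 1" and id: "(\<lambda>x. x) \<in> borel_measurable M"
    and "finite_moment p M" "transport_entropy p c M" "c > 0"
    and g: "g \<in> borel_measurable M"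
    and lip: "\<And>x y. \<bar>g x - g y\<bar> \<le> norm (x - y)" and "0 \<le> s"
  shows "(\<integral>\<^sup>+x. ennreal (exp (s * g x)) \<partial>M) \<le> ennreal (exp (s * (\<integral>x. g x \<partial>M) + c * s\<^sup>2 / 2))"
proof -
  define f where "f = (\<lambda>k::nat. \<lambda>x. ennreal (exp (s * min (g x) (real k))))"
  note [measurable] = g
  have norm_int: "integrable M norm"
    using assms(1) id assms(2,4) by (rule integrable_norm_of_finite_moment)
  have gM: "integrable M g"
    using assms(1) norm_int g lip by (rule lipschitz_integrable)
  have "incseq f"
    unfolding f_def using \<open>0 \<le> s\<close>
    by (intro incseq_SucI le_funI ennreal_leI) (auto intro!: mult_left_mono)
  have sup: "(SUP k. f k x) = ennreal (exp (s * g x))" for x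
  proof (rule antisym)
    show "(SUP k. f k x) \<le> ennreal (exp (s * g x))"
      unfolding f_def using \<open>0 \<le> s\<close> by (intro SUP_least ennreal_leI) (auto intro!: mult_left_mono)
    obtain k where "g x \<le> real k"
      using real_arch_simple by blast
    then have "ennreal (exp (s * g x)) = f k x"
      by (simp add: f_def)
    then show "ennreal (exp (s * g x)) \<le> (SUP k. f k x)"
      by (metis SUP_upper UNIV_I)
  qed
  have "(\<integral>\<^sup>+x. ennreal (exp (s * g x)) \<partial>M) = (SUP k. \<integral>\<^sup>+x. f k x \<partial>M)"
    using \<open>incseq f\<close>
    by (subst nn_integral_monotone_convergence_SUP[symmetric]) (auto simp: sup, simp add: f_def)
  also have "\<dots> \<le> ennreal (exp (s * (\<integral>x. g x \<partial>M) + c * s\<^sup>2 / 2))"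
  proof (rule SUP_least)
    fix k :: nat
    have lip_min: "\<bar>min (g x) (real k) - min (g y) (real k)\<bar> \<le> norm (x - y)" for x y
      using lip[of x y] by linarith
    have "integrable M (\<lambda>x. min (g x) (real k))"
      using assms(1) norm_int _ lip_min by (rule lipschitz_integrable) measurable
    then have "(\<integral>x. min (g x) (real k) \<partial>M) \<le> (\<integral>x. g x \<partial>M)"
      using gM by (intro integral_mono) auto
    then have mono: "exp (s * (\<integral>x. min (g x) (real k) \<partial>M) + c * s\<^sup>2 / 2)
        \<le> exp (s * (\<integral>x. g x \<partial>M) + c * s\<^sup>2 / 2)"
      using \<open>0 \<le> s\<close> by (simp add: mult_left_mono)
    have "(\<integral>\<^sup>+x. f k x \<partial>M) \<le> ennreal (exp (s * (\<integral>x. min (g x) (real k) \<partial>M) + c * s\<^sup>2 / 2))"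
      unfolding f_def using assms(1,2) id assms(4-6) _ _ lip_min \<open>0 \<le> s\<close>
      by (rule exp_moment_le_of_bounded_above[where K = "real k"]) auto
    also have "\<dots> \<le> ennreal (exp (s * (\<integral>x. g x \<partial>M) + c * s\<^sup>2 / 2))"
      using mono by (rule ennreal_leI)
    finally show "(\<integral>\<^sup>+x. f k x \<partial>M) \<le> ennreal (exp (s * (\<integral>x. g x \<partial>M) + c * s\<^sup>2 / 2))" .
  qed
  finally show ?thesis .
qed

section \<open>Concentration of the empirical mean\<close>

lemma sample_mean_deviation:
  fixes M :: "'a measure" and g :: "'a \<Rightarrow> real"
  assumes "prob_space M" "N \<ge> 1" "c > 0" "0 < t" and g: "g \<in> borel_measurable M"
    and mgf: "\<And>s. 0 \<le> s \<Longrightarrow> (\<integral>\<^sup>+x. ennreal (exp (s * g x)) \<partial>M) \<le> ennreal (exp (s * m + c * s\<^sup>2 / 2))"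
  shows "measure (PiM {..<N} (\<lambda>_. M))
           {x \<in> space (PiM {..<N} (\<lambda>_. M)). (\<Sum>i<N. g (x i)) / real N - m \<le> t}
         \<ge> 1 - exp (- (real N * t\<^sup>2 / (2 * c)))"
proof -
  interpret M: prob_space M by fact
  interpret prod: product_sigma_finite "\<lambda>_::nat. M"
    by unfold_locales
  interpret prob_space "PiM {..<N} (\<lambda>_. M)"
    by (intro prob_space_PiM assms(1))
  let ?\<Omega> = "PiM {..<N} (\<lambda>_. M)"
  note [measurable] = g
  \<comment> \<open>The minimizer of the Chernoff exponent \<open>N * (c * s\<^sup>2 / 2 - s * t)\<close>.\<close>
  define s where "s = t / c"
  have s: "s > 0"
    using assms by (simp add: s_def)
  define S where "S = (\<lambda>x. \<Sum>i<N. g (x i))"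
  have S[measurable]: "S \<in> borel_measurable ?\<Omega>"
    unfolding S_def by measurable
  have "(\<integral>\<^sup>+x. ennreal (exp (s * S x)) \<partial>?\<Omega>) = (\<integral>\<^sup>+x. (\<Prod>i<N. ennreal (exp (s * g (x i)))) \<partial>?\<Omega>)"
    by (simp add: S_def sum_distrib_left exp_sum prod_ennreal)
  also have "\<dots> = (\<Prod>i<N. \<integral>\<^sup>+x. ennreal (exp (s * g x)) \<partial>M)"
    by (intro prod.product_nn_integral_prod) auto
  also have "\<dots> \<le> (\<Prod>i<N. ennreal (exp (s * m + c * s\<^sup>2 / 2)))"
    using s by (intro prod_mono_ennreal mgf) auto
  also have "\<dots> = ennreal (exp (real N * (s * m + c * s\<^sup>2 / 2)))"
    by (simp add: ennreal_power exp_of_nat_mult)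
  finally have mgf_S: "(\<integral>\<^sup>+x. ennreal (exp (s * S x)) \<partial>?\<Omega>)
      \<le> ennreal (exp (real N * (s * m + c * s\<^sup>2 / 2)))" .
  define a where "a = real N * (m + t)"
  have "emeasure ?\<Omega> {x \<in> space ?\<Omega>. S x \<ge> a}
      \<le> ennreal (exp (- s * a)) * (\<integral>\<^sup>+x. ennreal (exp (s * S x)) * indicator (space ?\<Omega>) x \<partial>?\<Omega>)"
    by (intro Chernoff_ineq_nn_integral_ge s) auto
  also have "(\<integral>\<^sup>+x. ennreal (exp (s * S x)) * indicator (space ?\<Omega>) x \<partial>?\<Omega>)
      = (\<integral>\<^sup>+x. ennreal (exp (s * S x)) \<partial>?\<Omega>)"
    by (intro nn_integral_cong) simp
  also have "ennreal (exp (- s * a)) * \<dots>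
      \<le> ennreal (exp (- s * a)) * ennreal (exp (real N * (s * m + c * s\<^sup>2 / 2)))"
    by (intro mult_left_mono mgf_S) simp
  also have "\<dots> = ennreal (exp (- s * a + real N * (s * m + c * s\<^sup>2 / 2)))"
    by (simp add: mult_exp_exp flip: ennreal_mult)
  also have "- s * a + real N * (s * m + c * s\<^sup>2 / 2) = - (real N * t\<^sup>2 / (2 * c))"
    using \<open>c > 0\<close> by (simp add: s_def a_def field_simps power2_eq_square)
  finally have bad: "prob {x \<in> space ?\<Omega>. S x \<ge> a} \<le> exp (- (real N * t\<^sup>2 / (2 * c)))"
    by (simp add: emeasure_eq_measure)
  have "1 - prob {x \<in> space ?\<Omega>. S x \<ge> a} = prob (space ?\<Omega> - {x \<in> space ?\<Omega>. S x \<ge> a})"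
    by (intro prob_compl[symmetric]) measurable
  also have "\<dots> \<le> prob {x \<in> space ?\<Omega>. S x / real N - m \<le> t}"
    using assms(2) by (intro finite_measure_mono) (auto simp: a_def field_simps)
  finally show ?thesis
    using bad by (simp add: S_def)
qed

section \<open>Quadratic forms of matrices\<close>

text \<open>The Frobenius norm dominates the operator norm, by Cauchy-Schwarz in each row.\<close>

lemma norm_matrix_vector_mult_le:
  fixes A :: "real^'n^'m"
  shows "norm (A *v y) \<le> norm A * norm y"
proof -
  have "norm (A *v y) = L2_set (\<lambda>i. \<bar>A $ i \<bullet> y\<bar>) UNIV"
    by (simp add: norm_vec_def matrix_mult_dot)
  also have "\<dots> \<le> L2_set (\<lambda>i. norm (A $ i) * norm y) UNIV"
    by (intro L2_set_mono Cauchy_Schwarz_ineq2) simp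
  also have "\<dots> = norm A * norm y"
    by (simp add: norm_vec_def[of A] L2_set_left_distrib)
  finally show ?thesis .
qed

lemma bounded_linear_quadratic_form:
  fixes y :: "real^'n"
  shows "bounded_linear (\<lambda>A::real^'n^'n. y \<bullet> (A *v y))"
proof (rule bounded_linear_intro[where K = "norm y * norm y"])
  fix A B :: "real^'n^'n" and r :: real
  show "y \<bullet> ((A + B) *v y) = y \<bullet> (A *v y) + y \<bullet> (B *v y)"
    by (simp add: matrix_vector_mult_add_rdistrib inner_add_right)
  show "y \<bullet> ((r *\<^sub>R A) *v y) = r *\<^sub>R (y \<bullet> (A *v y))"
    by (simp add: scaleR_matrix_vector_assoc[symmetric])
  have "\<bar>y \<bullet> (A *v y)\<bar> \<le> norm y * norm (A *v y)"
    by (rule Cauchy_Schwarz_ineq2)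
  also have "\<dots> \<le> norm y * (norm A * norm y)"
    by (intro mult_left_mono norm_matrix_vector_mult_le) simp
  finally show "norm (y \<bullet> (A *v y)) \<le> norm A * (norm y * norm y)"
    by (simp add: mult_ac)
qed

lemma quadratic_form_lipschitz:
  fixes A B :: "real^'n^'n"
  assumes "norm y = 1"
  shows "\<bar>y \<bullet> (A *v y) - y \<bullet> (B *v y)\<bar> \<le> norm (A - B)"
proof -
  have "y \<bullet> (A *v y) - y \<bullet> (B *v y) = y \<bullet> ((A - B) *v y)"
    by (simp add: inner_diff_right matrix_vector_mult_diff_rdistrib)
  also have "\<bar>\<dots>\<bar> \<le> norm y * norm ((A - B) *v y)"
    by (rule Cauchy_Schwarz_ineq2)
  also have "\<dots> \<le> norm (A - B)"
    using norm_matrix_vector_mult_le[of "A - B" y] assms by simp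
  finally show ?thesis by simp
qed

section \<open>The confidence bound\<close>

theorem theorem4p14:
  fixes P_true :: "(real^'n^'n) measure"
    and y :: "real^'n"
    and N :: nat
    and p c \<beta> :: real
  assumes "N \<ge> 1"
    and "1 \<le> p" "p \<le> 2"
    and "sym_distribution P_true" "finite_moment p P_true"
    and "c > 0"
    and "\<forall>P. sym_distribution P \<and> finite_moment p P \<longrightarrow>
           wasserstein p P P_true \<le> ennreal_powr (ennreal (2 * c) * rel_entropy P P_true) (1 / 2)"
    and "0 < \<beta>" "\<beta> < 1"
    and "y \<in> sphere 0 1"
  shows "measure (PiM {..<N} (\<lambda>_. P_true))
           {Q \<in> space (PiM {..<N} (\<lambda>_. P_true)).
              y \<bullet> (((1 / real N) *\<^sub>R (\<Sum>i<N. Q i) - (\<integral>Q. Q \<partial>P_true)) *v y)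
                \<le> sqrt (2 * c * ln (1 / \<beta>) / real N)}
         \<ge> 1 - \<beta>"
proof -
  have P: "prob_space P_true" and sets_P: "sets P_true = sets (restrict_space borel sym_mats)"
    using assms(4) by (auto simp: sym_distribution_def)
  have id: "(\<lambda>x. x) \<in> borel_measurable P_true"
    using measurable_restrict_space1[of "\<lambda>x. x" borel borel sym_mats]
    by (simp cong: measurable_cong_sets add: sets_P)
  have T: "transport_entropy p c P_true"
    using assms(7) by (simp add: transport_entropy_def sym_distribution_def sets_P)
  define g where "g = (\<lambda>A::real^'n^'n. y \<bullet> (A *v y))"
  define m where "m = (\<integral>Q. g Q \<partial>P_true)"
  define t where "t = sqrt (2 * c * ln (1 / \<beta>) / real N)"
  have lin: "bounded_linear g"
    unfolding g_def by (rule bounded_linear_quadratic_form)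
  have lip: "\<bar>g A - g B\<bar> \<le> norm (A - B)" for A B
    unfolding g_def using assms(10) by (intro quadratic_form_lipschitz) simp
  have g: "g \<in> borel_measurable P_true"
    using measurable_compose[OF id, of g borel]
      borel_measurable_continuous_onI[OF linear_continuous_on[OF lin]] by simp
  have "integrable P_true norm"
    using P id assms(2,5) by (rule integrable_norm_of_finite_moment)
  then have "integrable P_true (\<lambda>Q. Q)"
    using id by (simp add: integrable_norm_iff)
  then have mean: "g (\<integral>Q. Q \<partial>P_true) = m"
    unfolding m_def by (rule integral_bounded_linear[OF lin, symmetric])
  have t: "t > 0"
    using assms by (simp add: t_def)
  have "t\<^sup>2 = 2 * c * ln (1 / \<beta>) / real N"
    unfolding t_def using assms by (intro real_sqrt_pow2) simp
  then have "real N * t\<^sup>2 / (2 * c) = ln (1 / \<beta>)"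
    using assms(1,6) by simp
  then have \<beta>: "exp (- (real N * t\<^sup>2 / (2 * c))) = \<beta>"
    using assms(8) by (simp add: ln_div)
  have "g ((1 / real N) *\<^sub>R (\<Sum>i<N. Q i) - (\<integral>Q. Q \<partial>P_true)) = (\<Sum>i<N. g (Q i)) / real N - m" for Q
  proof -
    interpret bounded_linear g by fact
    show ?thesis
      by (simp add: diff scale sum mean)
  qed
  moreover have "measure (PiM {..<N} (\<lambda>_. P_true))
      {Q \<in> space (PiM {..<N} (\<lambda>_. P_true)). (\<Sum>i<N. g (Q i)) / real N - m \<le> t}
    \<ge> 1 - exp (- (real N * t\<^sup>2 / (2 * c)))"
  proof (rule sample_mean_deviation[OF P assms(1,6) t g])
    show "(\<integral>\<^sup>+x. ennreal (exp (s * g x)) \<partial>P_true) \<le> ennreal (exp (s * m + c * s\<^sup>2 / 2))"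
      if "0 \<le> s" for s
      unfolding m_def
      using P assms(2) id assms(5) T assms(6) g lip that by (rule exp_moment_le_of_lipschitz)
  qed
  ultimately show ?thesis
    by (simp add: g_def t_def \<beta>[unfolded t_def])
qed

end
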